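(* Let $d \ge 2$ and $a$ be integers with $0 < a < d$, and let $k_i, q_i, p_i, \eta'_i$ be the quantities obtained from the extended Euclidean algorithm on $a$ and $d$, as described in the context. Let $b$ be an integer with $0 \le b \le d-1$, and suppose that $b$ is written in the $(q_i)_{i \le n}$ number scale as $$ b = 1 + \sum_{i=1}^{n+1} b_i q_{i-1}, $$ where $b_1,\dots,b_{n+1}$ are nonnegative integers satisfying the Markovian conditions $0 \le b_1 \le k_1 - 1$, $0 \le b_i \le k_i$ for $2 \le i \le n$, and $b_i = 0$ whenever $b_{i+1} = k_{i+1}$ (for $1 \le i \le n-1$). Then $$ a\cdot b \bmod d \;=\; a + \sum_{i=1}^{n+1} b_i \eta'_{i-1}, $$ where $a\cdot b \bmod d$ denotes the unique integer $c$ with $0 \le c < d$ and $c \equiv ab \pmod d$.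
   Context: Euclidean algorithm data: set $\theta'_{-1} = d$, $\theta'_0 = a$, and for $i \ge 1$, while $\theta'_{i-1} \neq 0$, put $k_i = \lfloor \theta'_{i-2}/\theta'_{i-1} \rfloor$ and $\theta'_i = \theta'_{i-2} - k_i \theta'_{i-1}$; let $n$ be the index with $\theta'_n = 0$ (so $a/d = [0; k_1, \dots, k_n]$ is the continued fraction expansion of $a/d$). Define $p_{-1} = 1$, $p_0 = 0$, $q_{-1} = 0$, $q_0 = 1$, and $p_i = p_{i-2} + k_i p_{i-1}$, $q_i = q_{i-2} + k_i q_{i-1}$ for $1 \le i \le n$. The signed remainders are $\eta'_i = (-1)^i \theta'_i$, which satisfy $\eta'_i = q_i a - p_i d$; in particular $\eta'_n = 0$.
   Formalization: The claim is proved under the extra assumption that a and d are coprime, or n is even, or d does not divide ab; otherwise the right side equals d rather than 0 (e.g. d=4, a=2, b=2, b_1=1, b_2=0). *)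

theory Defs
  imports Main
begin

text \<open>The sequences of the extended Euclidean algorithm start at index \<open>-1\<close>. The recursive functions
  \<open>rem_from\<close>, \<open>p_from\<close>, \<open>q_from\<close> are therefore shifted: their value at \<open>j\<close> is the entry of index
  \<open>j - 1\<close>. The quantities \<open>theta\<close>, \<open>quot\<close>, \<open>conv_p\<close>, \<open>conv_q\<close>, \<open>eta\<close> carry the usual indices.
  They are meaningful up to the index \<open>eucl_len a d\<close> at which the remainder vanishes; beyond it they
  are artefacts of \<open>x div 0 = 0\<close>.\<close>

fun rem_from :: "int \<Rightarrow> int \<Rightarrow> nat \<Rightarrow> int" where
  "rem_from a d 0 = d"
| "rem_from a d (Suc 0) = a"
| "rem_from a d (Suc (Suc j)) =
     rem_from a d j - (rem_from a d j div rem_from a d (Suc j)) * rem_from a d (Suc j)"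

definition theta :: "int \<Rightarrow> int \<Rightarrow> nat \<Rightarrow> int" where
  "theta a d i = rem_from a d (Suc i)"

text \<open>For \<open>i \<ge> 1\<close>, \<open>quot a d i\<close> is \<open>k\<^sub>i\<close>, the floor of the quotient of the remainders of indices
  \<open>i - 2\<close> and \<open>i - 1\<close>.\<close>

definition quot :: "int \<Rightarrow> int \<Rightarrow> nat \<Rightarrow> int" where
  "quot a d i = rem_from a d (i - 1) div rem_from a d i"

definition eucl_len :: "int \<Rightarrow> int \<Rightarrow> nat" where
  "eucl_len a d = (LEAST i. theta a d i = 0)"

fun p_from :: "int \<Rightarrow> int \<Rightarrow> nat \<Rightarrow> int" where
  "p_from a d 0 = 1"
| "p_from a d (Suc 0) = 0"
| "p_from a d (Suc (Suc j)) = p_from a d j + quot a d (Suc j) * p_from a d (Suc j)"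

fun q_from :: "int \<Rightarrow> int \<Rightarrow> nat \<Rightarrow> int" where
  "q_from a d 0 = 0"
| "q_from a d (Suc 0) = 1"
| "q_from a d (Suc (Suc j)) = q_from a d j + quot a d (Suc j) * q_from a d (Suc j)"

definition conv_p :: "int \<Rightarrow> int \<Rightarrow> nat \<Rightarrow> int" where
  "conv_p a d i = p_from a d (Suc i)"

definition conv_q :: "int \<Rightarrow> int \<Rightarrow> nat \<Rightarrow> int" where
  "conv_q a d i = q_from a d (Suc i)"

definition eta :: "int \<Rightarrow> int \<Rightarrow> nat \<Rightarrow> int" where
  "eta a d i = (- 1) ^ i * theta a d i"

lemma rem_from_conv:
  "(- 1) ^ j * rem_from a d (Suc j) = q_from a d (Suc j) * a - p_from a d (Suc j) * d \<and>
   (- 1) ^ Suc j * rem_from a d (Suc (Suc j)) =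
     q_from a d (Suc (Suc j)) * a - p_from a d (Suc (Suc j)) * d"
proof (induction j)
  case 0
  show ?case by (simp add: quot_def algebra_simps)
next
  case (Suc j)
  let ?k = "quot a d (Suc (Suc j))"
  have "(- 1) ^ Suc (Suc j) * rem_from a d (Suc (Suc (Suc j))) =
      (- 1) ^ j * rem_from a d (Suc j) + ?k * ((- 1) ^ Suc j * rem_from a d (Suc (Suc j)))"
    by (simp add: quot_def algebra_simps del: rem_from.simps(3) add: rem_from.simps(3)[of a d "Suc j"])
  also have "\<dots> = q_from a d (Suc (Suc (Suc j))) * a - p_from a d (Suc (Suc (Suc j))) * d"
    unfolding Suc.IH[THEN conjunct1] Suc.IH[THEN conjunct2]
      p_from.simps(3)[of a d "Suc j"] q_from.simps(3)[of a d "Suc j"]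
    by (simp only: algebra_simps)
  finally show ?case using Suc.IH by blast
qed

lemma eta_conv: "eta a d i = conv_q a d i * a - conv_p a d i * d"
  using rem_from_conv[of i a d] by (simp add: eta_def theta_def conv_q_def conv_p_def)

lemma rem_from_bounds:
  assumes "0 < a" "a < d" "\<And>j. theta a d j \<noteq> 0"
  shows "0 < rem_from a d (Suc j) \<and> rem_from a d (Suc j) + int j \<le> a"
proof (induction j)
  case 0
  show ?case using assms by simp
next
  case (Suc j)
  have eq: "rem_from a d (Suc (Suc j)) = rem_from a d j mod rem_from a d (Suc j)"
    by (simp add: minus_div_mult_eq_mod)
  have "rem_from a d (Suc (Suc j)) \<noteq> 0"
    using assms(3)[of "Suc j"] unfolding theta_def .
  moreover have "0 \<le> rem_from a d (Suc (Suc j))" "rem_from a d (Suc (Suc j)) < rem_from a d (Suc j)"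
    unfolding eq using Suc.IH by simp_all
  ultimately show ?case using Suc.IH by simp
qed

lemma theta_eucl_len:
  assumes "0 < a" "a < d"
  shows "theta a d (eucl_len a d) = 0"
proof -
  have "\<exists>j. theta a d j = 0"
  proof (rule ccontr)
    assume "\<not> ?thesis"
    then have "0 < rem_from a d (Suc (nat a)) \<and> rem_from a d (Suc (nat a)) + int (nat a) \<le> a"
      using rem_from_bounds[OF assms] by blast
    then show False using assms by auto
  qed
  then show ?thesis unfolding eucl_len_def by (rule LeastI_ex)
qed

end

theory Submission
  imports Defs
begin

text \<open>Since \<open>\<eta>'\<^sub>i = q\<^sub>i a - p\<^sub>i d\<close>, the claimed value is congruent to \<open>ab\<close> modulo \<open>d\<close>, and it remains to
  place it in \<open>[0, d)\<close>. The terms alternate in sign. Keeping only the negative ones, each of which is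
  at most \<open>k\<^sub>i \<theta>'\<^sub>i\<^sub>-\<^sub>1 = \<theta>'\<^sub>i\<^sub>-\<^sub>2 - \<theta>'\<^sub>i\<close> in size, telescoping gives the lower bound \<open>0\<close>; keeping only
  the positive ones gives the upper bound \<open>d\<close> in the same way. The value \<open>d\<close> itself can be attained
  only for odd \<open>n\<close>, and then \<open>d\<close> divides \<open>ab\<close>, which is impossible for \<open>0 < b < d\<close> if \<open>a\<close> and \<open>d\<close> are
  coprime.\<close>

lemma theta_Suc:
  "theta a d (Suc (Suc i)) = theta a d i - quot a d (Suc (Suc i)) * theta a d (Suc i)"
  by (simp add: theta_def quot_def)

lemma theta_Suc_mod: "theta a d (Suc (Suc i)) = theta a d i mod theta a d (Suc i)"
  by (simp add: theta_def minus_div_mult_eq_mod)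

lemma theta_1: "theta a d (Suc 0) = d - quot a d 1 * a"
  by (simp add: theta_def quot_def)

text \<open>No zero occurs before \<open>eucl_len\<close> by minimality, and a remainder modulo a
  positive number is nonnegative.\<close>

lemma theta_pos:
  assumes "0 < a" "a < d" "i < eucl_len a d"
  shows "0 < theta a d i"
  using assms(3)
proof (induction i)
  case 0
  then show ?case using assms(1) by (simp add: theta_def)
next
  case (Suc i)
  have "theta a d (Suc i) \<noteq> 0"
    using not_less_Least[of "Suc i" "\<lambda>i. theta a d i = 0"] Suc.prems by (simp add: eucl_len_def)
  moreover have "0 \<le> theta a d (Suc i)"
  proof (cases i)
    case 0
    then show ?thesis
      using assms(1) by (simp add: theta_def minus_div_mult_eq_mod)
  next
    case (Suc j)
    then show ?thesis using Suc.IH Suc.prems by (simp add: theta_Suc_mod)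
  qed
  ultimately show ?case by simp
qed

lemma conv_q_nonneg:
  assumes "0 < a" "a < d" "i \<le> eucl_len a d"
  shows "0 \<le> conv_q a d i"
proof -
  have quot: "0 \<le> quot a d (Suc j)" if "j < eucl_len a d" for j
  proof (cases j)
    case 0
    then show ?thesis using assms by (simp add: quot_def pos_imp_zdiv_nonneg_iff)
  next
    case (Suc m)
    then show ?thesis
      using theta_pos[OF assms(1,2), of m] theta_pos[OF assms(1,2), of j] that
      by (simp add: quot_def theta_def pos_imp_zdiv_nonneg_iff)
  qed
  \<comment> \<open>Two neighbours are carried along because the recurrence reaches back two
    places.\<close>
  have "i \<le> eucl_len a d \<Longrightarrow> 0 \<le> q_from a d i \<and> 0 \<le> q_from a d (Suc i)"
    by (induction i) (use quot in auto)
  then show ?thesis using assms(3) by (simp add: conv_q_def)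
qed

text \<open>Each new term moves only one end of the interval, by at most
  \<open>theta a d m - theta a d (Suc (Suc m))\<close>; which end depends on its sign, hence the
  split by parity.\<close>

lemma eta_partial_sum_bounds:
  assumes "0 < a" "a < d" "Suc m \<le> eucl_len a d"
    and nonneg: "\<And>i. 1 \<le> i \<Longrightarrow> i \<le> eucl_len a d \<Longrightarrow> 0 \<le> digit i"
    and first: "digit 1 \<le> quot a d 1 - 1"
    and upper: "\<And>i. 2 \<le> i \<Longrightarrow> i \<le> eucl_len a d \<Longrightarrow> digit i \<le> quot a d i"
  defines "T \<equiv> \<lambda>m. a + (\<Sum>i = 1..m. digit i * eta a d (i - 1))"
  shows "if even m then theta a d m \<le> T (Suc m) \<and> T (Suc m) \<le> d - theta a d (Suc m)
    else theta a d (Suc m) \<le> T (Suc m) \<and> T (Suc m) \<le> d - theta a d m"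
  using assms(3)
proof (induction m)
  case 0
  have "0 \<le> digit 1" using nonneg 0 by simp
  \<comment> \<open>The leading \<open>a\<close> takes up the unit left by \<open>first\<close>:
    \<open>(digit 1 + 1) * a\<close> is at most \<open>quot a d 1 * a\<close>, that is
    \<open>d - theta a d 1\<close>.\<close>
  then have "0 \<le> digit 1 * a" "digit 1 * a \<le> (quot a d 1 - 1) * a"
    using first assms(1) by (simp_all add: mult_right_mono)
  moreover have "T (Suc 0) = a + digit 1 * a" by (simp add: T_def eta_def theta_def)
  moreover have "theta a d 0 = a" by (simp add: theta_def)
  ultimately show ?case using theta_1[of a d] by (simp add: left_diff_distrib)
next
  case (Suc m)
  let ?t = "digit (Suc (Suc m)) * theta a d (Suc m)"
  have "0 < theta a d (Suc m)" using theta_pos assms(1,2) Suc.prems by simp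
  moreover have "0 \<le> digit (Suc (Suc m))" "digit (Suc (Suc m)) \<le> quot a d (Suc (Suc m))"
    using nonneg upper Suc.prems by simp_all
  ultimately have "0 \<le> ?t" "?t \<le> theta a d m - theta a d (Suc (Suc m))"
    by (simp_all add: theta_Suc mult_right_mono)
  moreover have "T (Suc (Suc m)) = T (Suc m) + (- 1) ^ Suc m * ?t"
    by (simp add: T_def eta_def)
  ultimately show ?case using Suc by (cases "even m") auto
qed

theorem theorem1:
  fixes a d b :: int and n :: nat and digit :: "nat \<Rightarrow> int"
  assumes "d \<ge> 2" and "0 < a" and "a < d"
    and "n = eucl_len a d"
    and "0 \<le> b" and "b \<le> d - 1"
    and "b = 1 + (\<Sum>i = 1..n + 1. digit i * conv_q a d (i - 1))"
    and "\<forall>i\<in>{1..n + 1}. 0 \<le> digit i"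
    and "digit 1 \<le> quot a d 1 - 1"
    and "\<forall>i\<in>{2..n}. digit i \<le> quot a d i"
    and "\<forall>i. 1 \<le> i \<and> i + 1 \<le> n \<longrightarrow> digit (i + 1) = quot a d (i + 1) \<longrightarrow> digit i = 0"
    and "coprime a d \<or> even n \<or> \<not> d dvd a * b"
  shows "(a * b) mod d = a + (\<Sum>i = 1..n + 1. digit i * eta a d (i - 1))"
proof -
  define V where "V = a + (\<Sum>i = 1..n + 1. digit i * eta a d (i - 1))"
  define P where "P = (\<Sum>i = 1..n + 1. digit i * conv_p a d (i - 1))"
  have theta_n: "theta a d n = 0" using theta_eucl_len assms(2-4) by simp
  moreover have "theta a d 0 = a" by (simp add: theta_def)
  ultimately obtain m where n: "n = Suc m" using assms(2) by (cases n) auto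
  \<comment> \<open>The last digit has no upper bound, but its factor \<open>eta a d n\<close> is 0,
    so the sum stops at \<open>n\<close>.\<close>
  have "V = a + (\<Sum>i = 1..Suc m. digit i * eta a d (i - 1))"
    using theta_n n by (simp add: V_def eta_def)
  moreover have "0 < theta a d m" using theta_pos assms(2-4) n by simp
  moreover have "if even m then theta a d m \<le> a + (\<Sum>i = 1..Suc m. digit i * eta a d (i - 1)) \<and>
        a + (\<Sum>i = 1..Suc m. digit i * eta a d (i - 1)) \<le> d - theta a d (Suc m)
      else theta a d (Suc m) \<le> a + (\<Sum>i = 1..Suc m. digit i * eta a d (i - 1)) \<and>
        a + (\<Sum>i = 1..Suc m. digit i * eta a d (i - 1)) \<le> d - theta a d m"
    by (rule eta_partial_sum_bounds) (use assms(2-4,8-10) n in auto)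
  \<comment> \<open>For even \<open>n\<close> the index \<open>m\<close> is odd, and the upper bound
    \<open>d - theta a d m\<close> lies strictly below \<open>d\<close>; for odd \<open>n\<close> it
    is only \<open>d - theta a d n = d\<close>.\<close>
  ultimately have V: "0 \<le> V" "V \<le> d" "even n \<Longrightarrow> V < d"
    using theta_n unfolding n by (simp_all split: if_splits)
  have "(\<Sum>i = 1..n + 1. digit i * eta a d (i - 1)) =
      a * (\<Sum>i = 1..n + 1. digit i * conv_q a d (i - 1)) - d * P"
    unfolding eta_conv P_def sum_distrib_left sum_subtractf[symmetric]
    by (rule sum.cong) (simp_all add: algebra_simps)
  then have ab: "a * b = V + d * P"
    unfolding V_def assms(7) by (simp add: algebra_simps)
  have "0 \<le> (\<Sum>i = 1..n + 1. digit i * conv_q a d (i - 1))"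
    using assms(2-4,8) conv_q_nonneg[of a d] by (intro sum_nonneg mult_nonneg_nonneg) auto
  then have "0 < b" using assms(7) by linarith
  then have "\<not> d dvd b" using assms(6) zdvd_not_zless by simp
  then have "coprime a d \<Longrightarrow> \<not> d dvd a * b"
    by (simp add: coprime_commute coprime_dvd_mult_right_iff)
  moreover have "V = d \<Longrightarrow> d dvd a * b" using ab by simp
  \<comment> \<open>Each alternative of the last hypothesis rules out \<open>V = d\<close>.\<close>
  ultimately have "V < d" using V assms(12) by fastforce
  then have "(a * b) mod d = V" using V ab by simp
  then show ?thesis by (simp only: V_def)
qed

end
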